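(* For any $f\in\mathcal D'_{\mathcal U,\Lambda}$, $g\in\mathcal C^\infty_{\mathcal U,\Lambda}$, $h\in\mathcal D'_{\mathcal V,\Lambda}$, $j\in\mathcal C^\infty_{\mathcal V,\Lambda}$ we have $$\widehat{f\star_{\mathcal U}g}=\widehat f\,\widehat g,\qquad \widehat{(h\star_{\mathcal V}j)}_{\ast}=\widehat h_{\ast}\,\widehat j_{\ast}.$$ The convolutions $\star_{\mathcal U}$ and $\star_{\mathcal V}$ are commutative and associative (for products in which at most one factor is a distribution and the remaining factors are test functions). If $g\in\mathcal C^\infty_{\mathcal U,\Lambda}$ then for all $f\in\mathcal D'_{\mathcal U,\Lambda}$ we have $f\star_{\mathcal U}g\in\mathcal C^\infty_{\mathcal U,\Lambda}$.
   Context: $\mathcal H$ is a separable complex Hilbert space with inner product $(\cdot,\cdot)$, linear in the first argument. $I$ is a discrete (countable) index set. $\mathcal U=\{u_\xi\}_{\xi\in I}$ is a Riesz basis of $\mathcal H$, and $\mathcal V=\{v_\xi\}_{\xi\in I}\subset\mathcal H$ is the system biorthogonal to $\mathcal U$: $(u_\xi,v_\eta)=\delta_{\xi\eta}$; then $\mathcal V$ is also a Riesz basis. $\Lambda=\{\lambda_\xi\}_{\xi\in I}$ is a fixed sequence of complex numbers such that $\sum_{\xi\in I}(1+|\lambda_\xi|)^{-s_0}<\infty$ for some $s_0>0$. Test functions: $\mathcal C^\infty_{\mathcal U,\Lambda}$ is the space of $\phi\in\mathcal H$ such that for every $k\in\{0,1,2,\dots\}$ there is $C$ with $|(\phi,v_\xi)|\le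 C(1+|\lambda_\xi|)^{-k}$ for all $\xi\in I$, topologized by the seminorms $\sup_{\xi}(1+|\lambda_\xi|)^k|(\phi,v_\xi)|$. $\mathcal C^\infty_{\mathcal V,\Lambda}$ is defined in the same way with $u_\xi$ in place of $v_\xi$. Distributions: $\mathcal D'_{\mathcal U,\Lambda}:=(\mathcal C^\infty_{\mathcal V,\Lambda})'$ and $\mathcal D'_{\mathcal V,\Lambda}:=(\mathcal C^\infty_{\mathcal U,\Lambda})'$ are the spaces of continuous antilinear functionals, with duality $\langle w,\phi\rangle$ extending the inner product: $\langle w,\phi\rangle=(w,\phi)$ when $w\in\mathcal H$ (so $\mathcal H$ embeds in both). Fourier transforms: $\widehat w(\xi)=(w,v_\xi):=\langle w,v_\xi\rangle$ for $w\in\mathcal D'_{\mathcal U,\Lambda}$ and $\widehat w_{\ast}(\xi)=(w,u_\xi):=\langle w,u_\xi\rangle$ for $w\in\mathcal D'_{\mathcal V,\Lambda}$, $\xi\in I$. Convolutions: for $f\in\mathcal D'_{\mathcal U,\Lambda}$, $g\in\mathcal C^\infty_{\mathcal U,\Lambda}$ (or with the roles of $f$ and $g$ swapped), $f\star_{\mathcal U}g:=\sum_{\xi\in I}\widehat f(\xi)\widehat g(\xi)u_\xi$; for $h\in\mathcal D'_{\mathcal V,\Lambda}$, $j\in\mathcal C^\infty_{\mathcal V,\Lambda}$ (or swapped), $h\star_{\mathcal V}j:=\sum_{\xi\in I}\widehat h_{\ast}(\xi)\widehat j_{\ast}(\xi)v_\xi$. These series converge in $\mathcal H$. *)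

theory Defs
  imports "HOL-Analysis.Analysis"
begin

text \<open>The complex inner product \<open>cinner\<close> is linear in its first argument.\<close>

class complex_hilbert = banach +
  fixes scaleC :: "complex \<Rightarrow> 'a \<Rightarrow> 'a" (infixr \<open>*\<^sub>C\<close> 75)
    and cinner :: "'a \<Rightarrow> 'a \<Rightarrow> complex"
  assumes scaleC_add_right: "c *\<^sub>C (x + y) = c *\<^sub>C x + c *\<^sub>C y"
    and scaleC_add_left: "(c + d) *\<^sub>C x = c *\<^sub>C x + d *\<^sub>C x"
    and scaleC_scaleC: "c *\<^sub>C d *\<^sub>C x = (c * d) *\<^sub>C x"
    and scaleC_one: "1 *\<^sub>C x = x"
    and scaleR_scaleC: "r *\<^sub>R x = complex_of_real r *\<^sub>C x"
    and cinner_commute: "cinner x y = cnj (cinner y x)"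
    and cinner_add_left: "cinner (x + y) z = cinner x z + cinner y z"
    and cinner_scaleC_left: "cinner (c *\<^sub>C x) y = c * cinner x y"
    and cinner_self: "cinner x x = complex_of_real ((norm x)\<^sup>2)"

global_interpretation complex_space:
  vector_space "scaleC :: complex \<Rightarrow> 'a \<Rightarrow> 'a::complex_hilbert"
  by unfold_locales (simp_all add: scaleC_add_right scaleC_add_left scaleC_scaleC scaleC_one)

definition bounded_clinear :: "('a::complex_hilbert \<Rightarrow> 'a) \<Rightarrow> bool" where
  "bounded_clinear T \<longleftrightarrow> bounded_linear T \<and> (\<forall>c x. T (c *\<^sub>C x) = c *\<^sub>C T x)"

definition biorthogonal ::
  "'i set \<Rightarrow> ('i \<Rightarrow> 'a::complex_hilbert) \<Rightarrow> ('i \<Rightarrow> 'a) \<Rightarrow> bool" where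
  "biorthogonal I u v \<longleftrightarrow>
     (\<forall>\<xi>\<in>I. \<forall>\<eta>\<in>I. cinner (u \<xi>) (v \<eta>) = (if \<xi> = \<eta> then 1 else 0))"

definition orthonormal_basis :: "'i set \<Rightarrow> ('i \<Rightarrow> 'a::complex_hilbert) \<Rightarrow> bool" where
  "orthonormal_basis I e \<longleftrightarrow>
     biorthogonal I e e \<and> closure (complex_space.span (e ` I)) = UNIV"

text \<open>A Riesz basis is the image of an orthonormal basis under a bounded linear operator
  with bounded inverse.\<close>

definition riesz_basis :: "'i set \<Rightarrow> ('i \<Rightarrow> 'a::complex_hilbert) \<Rightarrow> bool" where
  "riesz_basis I u \<longleftrightarrow>
     (\<exists>e T S. orthonormal_basis I e \<and> bounded_clinear T \<and> bounded_clinear S \<and>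
        S \<circ> T = id \<and> T \<circ> S = id \<and> (\<forall>\<xi>\<in>I. u \<xi> = T (e \<xi>)))"

text \<open>In the following \<open>v\<close> is the system against which Fourier coefficients are taken.
  For a Riesz basis \<open>u\<close> with biorthogonal system \<open>v\<close>, the space of test functions attached
  to \<open>u\<close> is therefore \<open>test_space I lam v\<close>, the one attached to \<open>v\<close> is
  \<open>test_space I lam u\<close>, and the space of distributions attached to \<open>u\<close> is
  \<open>antidual I lam u\<close>, the dual of the latter, into which \<open>hilbert_embed I lam u\<close> maps the
  Hilbert space.\<close>

definition test_space ::
  "'i set \<Rightarrow> ('i \<Rightarrow> complex) \<Rightarrow> ('i \<Rightarrow> 'a::complex_hilbert) \<Rightarrow> 'a set" where
  "test_space I lam v =
     {\<phi>. \<forall>k::nat. \<exists>C::real. \<forall>\<xi>\<in>I.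
        cmod (cinner \<phi> (v \<xi>)) \<le> C * (1 + cmod (lam \<xi>)) powr (- real k)}"

definition test_seminorm ::
  "'i set \<Rightarrow> ('i \<Rightarrow> complex) \<Rightarrow> ('i \<Rightarrow> 'a::complex_hilbert) \<Rightarrow> nat \<Rightarrow> 'a \<Rightarrow> real" where
  "test_seminorm I lam v k \<phi> = (SUP \<xi>\<in>I. (1 + cmod (lam \<xi>)) ^ k * cmod (cinner \<phi> (v \<xi>)))"

definition test_topology ::
  "'i set \<Rightarrow> ('i \<Rightarrow> complex) \<Rightarrow> ('i \<Rightarrow> 'a::complex_hilbert) \<Rightarrow> 'a topology" where
  "test_topology I lam v = topology_generated_by
     {{\<psi> \<in> test_space I lam v. test_seminorm I lam v k (\<psi> - \<phi>) < \<epsilon>} | k \<phi> \<epsilon>.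
        \<phi> \<in> test_space I lam v \<and> \<epsilon> > 0}"

text \<open>A functional on the test space is represented by a function on the whole type that is
  \<open>undefined\<close> outside the test space, so that equality of functionals is equality of functions.\<close>

definition antidual ::
  "'i set \<Rightarrow> ('i \<Rightarrow> complex) \<Rightarrow> ('i \<Rightarrow> 'a::complex_hilbert) \<Rightarrow> ('a \<Rightarrow> complex) set" where
  "antidual I lam v =
     {w \<in> extensional (test_space I lam v).
        (\<forall>\<phi>\<in>test_space I lam v. \<forall>\<psi>\<in>test_space I lam v. w (\<phi> + \<psi>) = w \<phi> + w \<psi>) \<and>
        (\<forall>c. \<forall>\<phi>\<in>test_space I lam v. w (c *\<^sub>C \<phi>) = cnj c * w \<phi>) \<and>
        continuous_map (test_topology I lam v) euclidean w}"

definition hilbert_embed ::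
  "'i set \<Rightarrow> ('i \<Rightarrow> complex) \<Rightarrow> ('i \<Rightarrow> 'a::complex_hilbert) \<Rightarrow> 'a \<Rightarrow> ('a \<Rightarrow> complex)" where
  "hilbert_embed I lam v w = (\<lambda>\<phi>\<in>test_space I lam v. cinner w \<phi>)"

definition fourier :: "('i \<Rightarrow> 'a::complex_hilbert) \<Rightarrow> ('a \<Rightarrow> complex) \<Rightarrow> 'i \<Rightarrow> complex" where
  "fourier v w \<xi> = w (v \<xi>)"

text \<open>Both arguments are functionals; a test function \<open>g\<close> enters through its image under
  \<open>hilbert_embed\<close>, whose Fourier transform is \<open>cinner g (v \<xi>)\<close>. The value is an element of the Hilbert space, the sum of the
  series in norm.\<close>

definition convolution ::
  "'i set \<Rightarrow> ('i \<Rightarrow> 'a::complex_hilbert) \<Rightarrow> ('i \<Rightarrow> 'a) \<Rightarrow> ('a \<Rightarrow> complex) \<Rightarrow> ('a \<Rightarrow> complex) \<Rightarrow> 'a"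
  where
  "convolution I u v f g = (\<Sum>\<^sub>\<infinity>\<xi>\<in>I. (fourier v f \<xi> * fourier v g \<xi>) *\<^sub>C u \<xi>)"

end

theory Submission
  imports Defs
begin

text \<open>
  A continuous functional on the test functions is controlled near \<open>0\<close> by finitely many
  seminorms, so evaluating it on the multiples of the dual basis vectors shows that the Fourier
  coefficients of a distribution grow at most polynomially in \<open>1 + \<bar>\<lambda>\<^sub>\<xi>\<bar>\<close>. Their product with the
  coefficients of a test function decreases rapidly, hence is absolutely summable, and the basis
  vectors are uniformly bounded; so the convolution series converges absolutely. By
  biorthogonality its coefficients are the products, and everything else follows from
  commutativity and associativity of pointwise multiplication.
\<close>

section \<open>Algebra of the complex inner product and the Cauchy-Schwarz inequality\<close>

lemma cinner_scaleC_right: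
  "cinner x (c *\<^sub>C y) = cnj c * cinner x (y::'a::complex_hilbert)"
  by (metis cinner_commute cinner_scaleC_left complex_cnj_mult)

lemma cinner_minus_left: "cinner (- x) y = - cinner x (y::'a::complex_hilbert)"
  using cinner_scaleC_left[of "-1" x y] complex_space.scale_minus_left[of 1 x]
  by (simp add: scaleC_one)

lemma cinner_diff_left:
  "cinner (x - y) z = cinner x z - cinner y (z::'a::complex_hilbert)"
  using cinner_add_left[of x "- y" z] by (simp add: cinner_minus_left)

lemma cinner_zero_left: "cinner 0 y = 0"
  using cinner_diff_left[of 0 0 y] by simp

lemma cinner_diff_right:
  "cinner x (y - z) = cinner x y - cinner x (z::'a::complex_hilbert)"
  by (metis cinner_commute cinner_diff_left complex_cnj_diff)

lemma norm_scaleC: "norm (c *\<^sub>C x) = cmod c * norm (x::'a::complex_hilbert)"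
proof -
  have "complex_of_real ((norm (c *\<^sub>C x))\<^sup>2) = cinner (c *\<^sub>C x) (c *\<^sub>C x)"
    by (simp add: cinner_self)
  also have "\<dots> = (c * cnj c) * cinner x x"
    by (simp add: cinner_scaleC_left cinner_scaleC_right)
  also have "\<dots> = complex_of_real ((cmod c * norm x)\<^sup>2)"
    by (simp add: cinner_self complex_norm_square[symmetric] power_mult_distrib)
  finally have "(norm (c *\<^sub>C x))\<^sup>2 = (cmod c * norm x)\<^sup>2"
    using of_real_eq_iff by blast
  then show ?thesis by simp
qed

text \<open>For nonzero \<open>y\<close>, subtracting from \<open>x\<close> its orthogonal
  projection onto \<open>y\<close> leaves a vector whose squared norm is the difference of the two
  sides, up to the factor \<open>(norm y)^2\<close>.\<close>

lemma cinner_Cauchy_Schwarz: "cmod (cinner x y) \<le> norm x * norm (y::'a::complex_hilbert)"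
proof (cases "y = 0")
  case True
  then show ?thesis
    using cinner_diff_right[of x 0 0] by simp
next
  case False
  define c where "c = cinner x y / complex_of_real ((norm y)\<^sup>2)"
  have y: "complex_of_real ((norm y)\<^sup>2) \<noteq> 0" using False by simp
  have "complex_of_real ((norm (x - c *\<^sub>C y))\<^sup>2) = cinner (x - c *\<^sub>C y) (x - c *\<^sub>C y)"
    by (simp add: cinner_self)
  also have "\<dots> = cinner x x - cnj c * cinner x y
      - (c * cnj (cinner x y) - c * cnj c * cinner y y)"
    using cinner_commute[of y x]
    by (simp add: cinner_diff_left cinner_diff_right cinner_scaleC_left cinner_scaleC_right
        algebra_simps)
  also have "c * cnj c * cinner y y = c * cnj (cinner x y)"
  proof -
    have "cnj c * cinner y y = cnj (cinner x y)"
      using y by (simp add: cinner_self c_def)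
    then show ?thesis by (simp only: mult.assoc)
  qed
  also have "cinner x x - cnj c * cinner x y - (c * cnj (cinner x y) - c * cnj (cinner x y))
      = complex_of_real ((norm x)\<^sup>2) - cinner x y * cnj (cinner x y) / complex_of_real ((norm y)\<^sup>2)"
    using y by (simp add: cinner_self c_def mult.commute)
  also have "\<dots> = complex_of_real ((norm x)\<^sup>2 - (cmod (cinner x y))\<^sup>2 / (norm y)\<^sup>2)"
    by (simp add: complex_norm_square[symmetric])
  finally have "(norm (x - c *\<^sub>C y))\<^sup>2 = (norm x)\<^sup>2 - (cmod (cinner x y))\<^sup>2 / (norm y)\<^sup>2"
    using of_real_eq_iff by blast
  then have "(cmod (cinner x y))\<^sup>2 / (norm y)\<^sup>2 \<le> (norm x)\<^sup>2"
    by (metis diff_ge_0_iff_ge zero_le_power2)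
  then have "(cmod (cinner x y))\<^sup>2 \<le> (norm x * norm y)\<^sup>2"
    using False by (simp add: divide_le_eq power_mult_distrib)
  then show ?thesis by (rule power2_le_imp_le) simp
qed

lemma bounded_linear_cinner_left: "bounded_linear (\<lambda>x. cinner x (y::'a::complex_hilbert))"
proof (rule bounded_linear_intro)
  show "norm (cinner x y) \<le> norm x * norm y" for x
    by (rule cinner_Cauchy_Schwarz)
qed (simp_all add: cinner_add_left scaleR_scaleC cinner_scaleC_left scaleR_conv_of_real)

section \<open>Uniform norm bounds for a Riesz basis and its biorthogonal system\<close>

lemma biorthogonal_sym: "biorthogonal I u v \<Longrightarrow> biorthogonal I v u"
  unfolding biorthogonal_def by (metis cinner_commute complex_cnj_one complex_cnj_zero)

lemma norm_orthonormal_basis: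
  assumes "orthonormal_basis I e" and "\<xi> \<in> I"
  shows "norm (e \<xi>) = 1"
proof -
  have "complex_of_real ((norm (e \<xi>))\<^sup>2) = 1"
    using assms unfolding cinner_self[symmetric] orthonormal_basis_def biorthogonal_def by simp
  then have "(norm (e \<xi>))\<^sup>2 = 1" using of_real_eq_1_iff by blast
  then show ?thesis using power2_eq_imp_eq[of "norm (e \<xi>)" 1] by simp
qed

lemma riesz_basis_bounded:
  assumes "riesz_basis I (u :: 'i \<Rightarrow> 'a::complex_hilbert)"
  shows "\<exists>B. \<forall>\<xi>\<in>I. norm (u \<xi>) \<le> B"
proof -
  obtain e and T :: "'a \<Rightarrow> 'a" where e: "orthonormal_basis I e" and T: "bounded_linear T"
    and u: "\<And>\<xi>. \<xi> \<in> I \<Longrightarrow> u \<xi> = T (e \<xi>)"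
    using assms unfolding riesz_basis_def bounded_clinear_def by blast
  have "norm (u \<xi>) \<le> onorm T" if "\<xi> \<in> I" for \<xi>
    using onorm[OF T, of "e \<xi>"] that norm_orthonormal_basis[OF e that] by (simp add: u)
  then show ?thesis by blast
qed

text \<open>With \<open>u = T e\<close>, the biorthogonal system is \<open>(T\<^sup>-\<^sup>1)\<^sup>* e\<close>. Testing the defining
  identity of the adjoint on \<open>v \<eta>\<close> itself bounds its norm without constructing the adjoint.\<close>

lemma riesz_basis_biorthogonal_bounded:
  assumes riesz: "riesz_basis I (u :: 'i \<Rightarrow> 'a::complex_hilbert)"
    and biorth: "biorthogonal I u v"
  shows "\<exists>B. \<forall>\<xi>\<in>I. norm (v \<xi>) \<le> B"
proof -
  obtain e and T S :: "'a \<Rightarrow> 'a" where e: "orthonormal_basis I e" and T: "bounded_linear T"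
    and TC: "\<And>c x. T (c *\<^sub>C x) = c *\<^sub>C T x"
    and S: "bounded_linear S" and TS: "T \<circ> S = id"
    and u: "\<And>\<xi>. \<xi> \<in> I \<Longrightarrow> u \<xi> = T (e \<xi>)"
    using riesz unfolding riesz_basis_def bounded_clinear_def by blast
  have "norm (v \<eta>) \<le> onorm S" if \<eta>: "\<eta> \<in> I" for \<eta>
  proof -
    \<comment> \<open>The identity holds at the basis vectors by biorthogonality. Both sides are
      linear and continuous in \<open>y\<close>, so it extends to the closed span, which is the
      whole space.\<close>
    let ?E = "{y. cinner (T y) (v \<eta>) = cinner y (e \<eta>)}"
    have "e ` I \<subseteq> ?E"
      using e biorth \<eta> u unfolding orthonormal_basis_def biorthogonal_def by auto
    moreover have "complex_space.subspace ?E"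
      using linear_0[OF bounded_linear.linear[OF T]]
      by (auto simp: complex_space.subspace_def cinner_zero_left linear_add[OF bounded_linear.linear[OF T]]
          TC cinner_add_left cinner_scaleC_left)
    ultimately have "complex_space.span (e ` I) \<subseteq> ?E"
      by (rule complex_space.span_minimal)
    moreover have "closed ?E"
      by (intro closed_Collect_eq bounded_linear.continuous_on[OF bounded_linear_cinner_left]
          bounded_linear.continuous_on[OF T] continuous_on_id)
    ultimately have "?E = UNIV"
      using e closure_minimal unfolding orthonormal_basis_def by (metis top.extremum_uniqueI)
    then have "cinner (T (S (v \<eta>))) (v \<eta>) = cinner (S (v \<eta>)) (e \<eta>)" by blast
    then have "complex_of_real ((norm (v \<eta>))\<^sup>2) = cinner (S (v \<eta>)) (e \<eta>)"
      using TS by (simp add: cinner_self fun_eq_iff)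
    then have "(norm (v \<eta>))\<^sup>2 = cmod (cinner (S (v \<eta>)) (e \<eta>))"
      by (metis abs_power2 norm_of_real)
    also have "\<dots> \<le> norm (S (v \<eta>)) * norm (e \<eta>)"
      by (rule cinner_Cauchy_Schwarz)
    also have "\<dots> \<le> onorm S * norm (v \<eta>)"
      using onorm[OF S, of "v \<eta>"] norm_orthonormal_basis[OF e \<eta>] by simp
    finally show ?thesis
      using onorm_pos_le[OF S] by (cases "norm (v \<eta>) = 0") (auto simp: power2_eq_square)
  qed
  then show ?thesis by blast
qed

section \<open>Decay and growth of coefficient families\<close>

text \<open>The test space condition, stated for a bare family of coefficients so that pointwise
  products can be treated without reference to vectors.\<close>

definition rapidly_decreasing :: "'i set \<Rightarrow> ('i \<Rightarrow> complex) \<Rightarrow> ('i \<Rightarrow> complex) \<Rightarrow> bool" where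
  "rapidly_decreasing I lam a \<longleftrightarrow>
     (\<forall>k::nat. \<exists>C::real. \<forall>\<xi>\<in>I. cmod (a \<xi>) \<le> C * (1 + cmod (lam \<xi>)) powr (- real k))"

text \<open>The growth class that contains the Fourier coefficients of every distribution; its
  members act as multipliers on rapidly decreasing families.\<close>

definition polynomially_bounded :: "'i set \<Rightarrow> ('i \<Rightarrow> complex) \<Rightarrow> ('i \<Rightarrow> complex) \<Rightarrow> bool" where
  "polynomially_bounded I lam a \<longleftrightarrow>
     (\<exists>(N::nat) C::real. \<forall>\<xi>\<in>I. cmod (a \<xi>) \<le> C * (1 + cmod (lam \<xi>)) ^ N)"

lemma mem_test_space_iff:
  "\<phi> \<in> test_space I lam v \<longleftrightarrow> rapidly_decreasing I lam (\<lambda>\<xi>. cinner \<phi> (v \<xi>))"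
  by (simp add: test_space_def rapidly_decreasing_def)

lemma rapidly_decreasing_cong:
  "(\<And>\<xi>. \<xi> \<in> I \<Longrightarrow> a \<xi> = b \<xi>) \<Longrightarrow> rapidly_decreasing I lam a \<longleftrightarrow> rapidly_decreasing I lam b"
  by (simp add: rapidly_decreasing_def)

lemma rapidly_decreasing_imp_polynomially_bounded:
  assumes "rapidly_decreasing I lam a"
  shows "polynomially_bounded I lam a"
proof -
  obtain C where "\<And>\<xi>. \<xi> \<in> I \<Longrightarrow> cmod (a \<xi>) \<le> C * (1 + cmod (lam \<xi>)) powr (- real 0)"
    using assms unfolding rapidly_decreasing_def by blast
  then have "\<forall>\<xi>\<in>I. cmod (a \<xi>) \<le> C * (1 + cmod (lam \<xi>)) ^ 0"
    by (metis of_nat_0 minus_zero powr_zero_eq_one power_0 add_pos_nonneg norm_ge_zero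
        order_less_irrefl zero_less_one)
  then show ?thesis unfolding polynomially_bounded_def by blast
qed

lemma rapidly_decreasing_mult:
  assumes a: "polynomially_bounded I lam a" and b: "rapidly_decreasing I lam b"
  shows "rapidly_decreasing I lam (\<lambda>\<xi>. a \<xi> * b \<xi>)"
  unfolding rapidly_decreasing_def
proof
  fix k :: nat
  obtain N A where A: "\<And>\<xi>. \<xi> \<in> I \<Longrightarrow> cmod (a \<xi>) \<le> A * (1 + cmod (lam \<xi>)) ^ N"
    using a unfolding polynomially_bounded_def by blast
  \<comment> \<open>Decay of order \<open>N + k\<close> is requested: \<open>N\<close> orders absorb
    the growth of \<open>a\<close>, and \<open>k\<close> remain.\<close>
  obtain B where B: "\<And>\<xi>. \<xi> \<in> I \<Longrightarrow> cmod (b \<xi>) \<le> B * (1 + cmod (lam \<xi>)) powr (- real (N + k))"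
    using b unfolding rapidly_decreasing_def by blast
  have "cmod (a \<xi> * b \<xi>) \<le> (A * B) * (1 + cmod (lam \<xi>)) powr (- real k)" if "\<xi> \<in> I" for \<xi>
  proof -
    let ?w = "1 + cmod (lam \<xi>)"
    have w: "?w > 0" by (simp add: add_pos_nonneg)
    have "cmod (a \<xi> * b \<xi>) \<le> (A * ?w ^ N) * (B * ?w powr (- real (N + k)))"
      unfolding norm_mult by (intro mult_mono' A B that norm_ge_zero)
    also have "\<dots> = (A * B) * (?w powr real N * ?w powr (- real (N + k)))"
      using w by (simp add: powr_realpow)
    also have "?w powr real N * ?w powr (- real (N + k)) = ?w powr (- real k)"
      unfolding powr_add[symmetric] by simp
    finally show ?thesis .
  qed
  then show "\<exists>C. \<forall>\<xi>\<in>I. cmod (a \<xi> * b \<xi>) \<le> C * (1 + cmod (lam \<xi>)) powr (- real k)" by blast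
qed

text \<open>This makes the \<open>SUP\<close> in \<open>test_seminorm\<close> a true upper bound, so
  that single coefficients can be estimated by it.\<close>

lemma bdd_above_test_seminorm:
  assumes "\<phi> \<in> test_space I lam v"
  shows "bdd_above ((\<lambda>\<xi>. (1 + cmod (lam \<xi>)) ^ k * cmod (cinner \<phi> (v \<xi>))) ` I)"
proof -
  obtain C where C: "\<And>\<xi>. \<xi> \<in> I \<Longrightarrow> cmod (cinner \<phi> (v \<xi>)) \<le> C * (1 + cmod (lam \<xi>)) powr (- real k)"
    using assms unfolding test_space_def by blast
  have "(1 + cmod (lam \<xi>)) ^ k * cmod (cinner \<phi> (v \<xi>)) \<le> C" if "\<xi> \<in> I" for \<xi>
  proof -
    have w: "1 + cmod (lam \<xi>) > 0" by (simp add: add_pos_nonneg)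
    have "(1 + cmod (lam \<xi>)) ^ k * cmod (cinner \<phi> (v \<xi>))
        \<le> (1 + cmod (lam \<xi>)) ^ k * (C * (1 + cmod (lam \<xi>)) powr (- real k))"
      using w by (intro mult_left_mono C that) simp
    also have "\<dots> = C"
      using w by (simp add: powr_minus powr_realpow)
    finally show ?thesis .
  qed
  then show ?thesis by (intro bdd_aboveI2)
qed

section \<open>Dual vectors as test functions\<close>

text \<open>Gathers the data behind one of the two convolutions. Interpreting it a second time with
  \<open>u\<close> and \<open>v\<close> exchanged gives the other. The Riesz property enters through
  the bound \<open>B\<close> on the vectors in which the series is expanded.\<close>

locale biorthogonal_system =
  fixes I :: "'i set" and u v :: "'i \<Rightarrow> 'a::complex_hilbert"
    and lam :: "'i \<Rightarrow> complex" and s B :: real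
  assumes biorthogonal: "biorthogonal I u v"
    and summable: "(\<lambda>\<xi>. (1 + cmod (lam \<xi>)) powr (- s)) summable_on I"
    and norm_le: "\<And>\<xi>. \<xi> \<in> I \<Longrightarrow> norm (u \<xi>) \<le> B"
begin

lemma cinner_eq: "\<xi> \<in> I \<Longrightarrow> \<eta> \<in> I \<Longrightarrow> cinner (u \<xi>) (v \<eta>) = (if \<xi> = \<eta> then 1 else 0)"
  using biorthogonal unfolding biorthogonal_def by blast

lemma cinner_eq': "\<xi> \<in> I \<Longrightarrow> \<eta> \<in> I \<Longrightarrow> cinner (v \<xi>) (u \<eta>) = (if \<xi> = \<eta> then 1 else 0)"
  using biorthogonal_sym[OF biorthogonal] unfolding biorthogonal_def by blast

lemma scaleC_dual_mem_test_space:
  assumes "\<xi> \<in> I"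
  shows "c *\<^sub>C v \<xi> \<in> test_space I lam u"
  unfolding test_space_def
proof (intro CollectI allI)
  fix k :: nat
  \<comment> \<open>The only possibly nonzero coefficient is \<open>c\<close>, at the index \<xi>;
    the constant is chosen to give equality there.\<close>
  have "cmod (cinner (c *\<^sub>C v \<xi>) (u \<eta>))
      \<le> (cmod c * (1 + cmod (lam \<xi>)) powr real k) * (1 + cmod (lam \<eta>)) powr (- real k)"
    if "\<eta> \<in> I" for \<eta>
  proof -
    have "1 + cmod (lam \<xi>) > 0" by (simp add: add_pos_nonneg)
    then show ?thesis
      using assms that
      by (auto simp: cinner_scaleC_left cinner_eq' powr_minus mult.assoc)
  qed
  then show "\<exists>C. \<forall>\<eta>\<in>I. cmod (cinner (c *\<^sub>C v \<xi>) (u \<eta>)) \<le> C * (1 + cmod (lam \<eta>)) powr (- real k)"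
    by blast
qed

lemma dual_mem_test_space: "\<xi> \<in> I \<Longrightarrow> v \<xi> \<in> test_space I lam u"
  using scaleC_dual_mem_test_space[of \<xi> 1] by (simp add: scaleC_one)

lemma zero_mem_test_space: "0 \<in> test_space I lam u"
  by (auto simp: test_space_def cinner_zero_left intro!: exI[of _ 0])

text \<open>Evaluation at \<open>v \<xi>\<close> avoids the value \<open>undefined\<close> of the
  embedded functional because \<open>v \<xi>\<close> lies in the test space.\<close>

lemma fourier_hilbert_embed:
  "\<xi> \<in> I \<Longrightarrow> fourier v (hilbert_embed I lam u g) \<xi> = cinner g (v \<xi>)"
  by (simp add: fourier_def hilbert_embed_def dual_mem_test_space)

text \<open>Triangle inequality for the seminorm, with the contribution of the single coefficient of
  \<open>c *\<^sub>C v \<xi>\<close> made explicit. The centre \<phi> is arbitrary because the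
  generating sets of the topology are not centred at 0; \<open>0 - \<phi>\<close> is the form in
  which membership of 0 in such a set appears.\<close>

lemma test_seminorm_scaleC_dual_diff:
  assumes \<xi>: "\<xi> \<in> I" and \<phi>: "\<phi> \<in> test_space I lam u"
  shows "test_seminorm I lam u k (c *\<^sub>C v \<xi> - \<phi>)
    \<le> cmod c * (1 + cmod (lam \<xi>)) ^ k + test_seminorm I lam u k (0 - \<phi>)"
  unfolding test_seminorm_def
proof (rule cSUP_least)
  show "I \<noteq> {}" using \<xi> by blast
next
  fix \<eta> assume \<eta>: "\<eta> \<in> I"
  have z: "cinner (0 - \<phi>) y = - cinner \<phi> y" for y
    by (simp add: cinner_minus_left)
  have "(1 + cmod (lam \<eta>)) ^ k * cmod (cinner (c *\<^sub>C v \<xi> - \<phi>) (u \<eta>))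
      \<le> (1 + cmod (lam \<eta>)) ^ k * (cmod (cinner (c *\<^sub>C v \<xi>) (u \<eta>)) + cmod (cinner (0 - \<phi>) (u \<eta>)))"
    unfolding cinner_diff_left[of "c *\<^sub>C v \<xi>"] z norm_minus_cancel
    by (intro mult_left_mono norm_triangle_ineq4) simp
  also have "\<dots> = (1 + cmod (lam \<eta>)) ^ k * cmod (cinner (c *\<^sub>C v \<xi>) (u \<eta>))
      + (1 + cmod (lam \<eta>)) ^ k * cmod (cinner (0 - \<phi>) (u \<eta>))"
    by (rule distrib_left)
  also have "\<dots> \<le> cmod c * (1 + cmod (lam \<xi>)) ^ k
      + (SUP \<eta>\<in>I. (1 + cmod (lam \<eta>)) ^ k * cmod (cinner (0 - \<phi>) (u \<eta>)))"
  proof (rule add_mono)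
    show "(1 + cmod (lam \<eta>)) ^ k * cmod (cinner (c *\<^sub>C v \<xi>) (u \<eta>)) \<le> cmod c * (1 + cmod (lam \<xi>)) ^ k"
      using \<xi> \<eta> by (auto simp: cinner_scaleC_left cinner_eq')
    show "(1 + cmod (lam \<eta>)) ^ k * cmod (cinner (0 - \<phi>) (u \<eta>))
      \<le> (SUP \<eta>\<in>I. (1 + cmod (lam \<eta>)) ^ k * cmod (cinner (0 - \<phi>) (u \<eta>)))"
      using bdd_above_test_seminorm[OF \<phi>, of k] \<eta> unfolding z norm_minus_cancel
      by (intro cSUP_upper)
  qed
  finally show "(1 + cmod (lam \<eta>)) ^ k * cmod (cinner (c *\<^sub>C v \<xi> - \<phi>) (u \<eta>))
      \<le> cmod c * (1 + cmod (lam \<xi>)) ^ k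
        + (SUP \<eta>\<in>I. (1 + cmod (lam \<eta>)) ^ k * cmod (cinner (0 - \<phi>) (u \<eta>)))" .
qed

section \<open>Neighbourhoods of zero and the coefficient growth of distributions\<close>

lemma topspace_test_topology: "topspace (test_topology I lam u) = test_space I lam u"
proof -
  \<comment> \<open>This radius avoids evaluating the seminorm at 0, which is a supremum over a
    possibly empty \<open>I\<close>.\<close>
  have "\<phi> \<in> {\<psi> \<in> test_space I lam u. test_seminorm I lam u 0 (\<psi> - \<phi>)
      < \<bar>test_seminorm I lam u 0 (\<phi> - \<phi>)\<bar> + 1}" if "\<phi> \<in> test_space I lam u" for \<phi>
    using that by auto
  moreover have "\<bar>x\<bar> + 1 > 0" for x :: real by simp
  ultimately show ?thesis
    unfolding test_topology_def topology_generated_by_topspace by blast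
qed

text \<open>Finitely many seminorms control a neighbourhood of 0; here this is recorded only along
  the lines spanned by the dual vectors, with \<open>N\<close> and \<delta> uniform in \<xi>. The
  proof is by induction on the generation of \<open>W\<close>: unions inherit the constants of the
  member containing 0, and intersections combine the constants of both sets.\<close>

lemma test_topology_nhds_0:
  assumes "openin (test_topology I lam u) W" and "0 \<in> W"
  shows "\<exists>(N::nat) \<delta>. \<delta> > 0 \<and>
    (\<forall>\<xi>\<in>I. \<forall>c. cmod c * (1 + cmod (lam \<xi>)) ^ N < \<delta> \<longrightarrow> c *\<^sub>C v \<xi> \<in> W)"
  using assms unfolding test_topology_def openin_topology_generated_by_iff
proof (induction rule: generate_topology_on.induct)
  case Empty
  then show ?case by simp
next
  case (Int W1 W2)
  obtain N1 \<delta>1 where 1: "\<delta>1 > 0"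
    "\<And>\<xi> c. \<xi> \<in> I \<Longrightarrow> cmod c * (1 + cmod (lam \<xi>)) ^ N1 < \<delta>1 \<Longrightarrow> c *\<^sub>C v \<xi> \<in> W1"
    using Int by (metis IntE)
  obtain N2 \<delta>2 where 2: "\<delta>2 > 0"
    "\<And>\<xi> c. \<xi> \<in> I \<Longrightarrow> cmod c * (1 + cmod (lam \<xi>)) ^ N2 < \<delta>2 \<Longrightarrow> c *\<^sub>C v \<xi> \<in> W2"
    using Int by (metis IntE)
  have "c *\<^sub>C v \<xi> \<in> W1 \<inter> W2"
    if "\<xi> \<in> I" "cmod c * (1 + cmod (lam \<xi>)) ^ max N1 N2 < min \<delta>1 \<delta>2" for \<xi> c
  proof -
    \<comment> \<open>The weight is at least 1, so smallness for the larger exponent implies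
      smallness for both.\<close>
    have "cmod c * (1 + cmod (lam \<xi>)) ^ n \<le> cmod c * (1 + cmod (lam \<xi>)) ^ max N1 N2"
      if "n \<le> max N1 N2" for n
      using that by (intro mult_left_mono power_increasing) auto
    from this[of N1] this[of N2] show ?thesis
      using that 1(2)[of \<xi> c] 2(2)[of \<xi> c] by auto
  qed
  then show ?case using 1(1) 2(1) by (intro exI[of _ "max N1 N2"] exI[of _ "min \<delta>1 \<delta>2"]) auto
next
  case (UN K)
  then show ?case by (metis UnionE UnionI)
next
  case (Basis W)
  then obtain k \<phi> \<epsilon> where
    W: "W = {\<psi> \<in> test_space I lam u. test_seminorm I lam u k (\<psi> - \<phi>) < \<epsilon>}"
    and \<phi>: "\<phi> \<in> test_space I lam u"
    by blast
  \<comment> \<open>The room left around 0 in the seminorm ball centred at \<phi>, positive because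
    0 belongs to \<open>W\<close>.\<close>
  let ?d = "\<epsilon> - test_seminorm I lam u k (0 - \<phi>)"
  have "c *\<^sub>C v \<xi> \<in> W" if "\<xi> \<in> I" "cmod c * (1 + cmod (lam \<xi>)) ^ k < ?d" for \<xi> c
    using test_seminorm_scaleC_dual_diff[OF that(1) \<phi>, of k c] that
      scaleC_dual_mem_test_space[OF that(1)] unfolding W by auto
  moreover have "?d > 0" using Basis(2) unfolding W by simp
  ultimately show ?case by blast
qed

text \<open>Continuity at 0 bounds \<open>f\<close> by 1 on sufficiently small multiples of each
  \<open>v \<xi>\<close>. Antilinearity turns the admissible size of the multiple into a bound on
  \<open>f (v \<xi>)\<close>.\<close>

lemma fourier_antidual_polynomially_bounded:
  assumes f: "f \<in> antidual I lam u"
  shows "polynomially_bounded I lam (fourier v f)"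
proof -
  have add: "f (\<phi> + \<psi>) = f \<phi> + f \<psi>"
    if "\<phi> \<in> test_space I lam u" "\<psi> \<in> test_space I lam u" for \<phi> \<psi>
    using f that unfolding antidual_def by blast
  have scale: "f (c *\<^sub>C \<phi>) = cnj c * f \<phi>" if "\<phi> \<in> test_space I lam u" for c \<phi>
    using f that unfolding antidual_def by blast
  have cont: "continuous_map (test_topology I lam u) euclidean f"
    using f unfolding antidual_def by blast
  have f0: "f 0 = 0"
    using add[OF zero_mem_test_space zero_mem_test_space] by simp
  let ?W = "{\<phi> \<in> topspace (test_topology I lam u). f \<phi> \<in> ball 0 1}"
  have "openin (test_topology I lam u) ?W"
    using cont by (rule openin_continuous_map_preimage) simp
  moreover have "0 \<in> ?W"
    using f0 zero_mem_test_space by (simp add: topspace_test_topology)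
  ultimately obtain N \<delta> where \<delta>: "\<delta> > 0"
    and W: "\<And>\<xi> c. \<xi> \<in> I \<Longrightarrow> cmod c * (1 + cmod (lam \<xi>)) ^ N < \<delta> \<Longrightarrow> c *\<^sub>C v \<xi> \<in> ?W"
    using test_topology_nhds_0[of ?W] by blast
  have "cmod (fourier v f \<xi>) \<le> 2 / \<delta> * (1 + cmod (lam \<xi>)) ^ N" if \<xi>: "\<xi> \<in> I" for \<xi>
  proof -
    let ?w = "(1 + cmod (lam \<xi>)) ^ N"
    have w: "?w > 0" by (simp add: add_pos_nonneg)
    \<comment> \<open>The weighted size of \<open>c\<close> is exactly half of \<delta>, hence
      within the strict bound; dividing by \<open>cmod c\<close> yields the constant
      \<open>2 / \<delta>\<close>.\<close>
    define c where "c = complex_of_real (\<delta> / 2 / ?w)"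
    have c: "cmod c = \<delta> / 2 / ?w"
      using w \<delta> unfolding c_def norm_of_real by simp
    then have "cmod c * ?w < \<delta>" using w \<delta> by simp
    then have "cmod (f (c *\<^sub>C v \<xi>)) < 1"
      using W[OF \<xi>, of c] by simp
    then have "\<delta> / 2 / ?w * cmod (f (v \<xi>)) < 1"
      by (simp add: scale[OF dual_mem_test_space[OF \<xi>]] norm_mult c)
    then show ?thesis
      using w \<delta> by (simp add: fourier_def field_simps)
  qed
  then show ?thesis unfolding polynomially_bounded_def by blast
qed

section \<open>Convergence and coefficients of rapidly decreasing series\<close>

lemma rapidly_decreasing_series_summable:
  assumes "rapidly_decreasing I lam a"
  shows "(\<lambda>\<xi>. a \<xi> *\<^sub>C u \<xi>) summable_on I"
proof (rule abs_summable_summable)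
  obtain k :: nat where k: "s \<le> real k" using real_arch_simple by blast
  obtain C where C: "\<And>\<xi>. \<xi> \<in> I \<Longrightarrow> cmod (a \<xi>) \<le> C * (1 + cmod (lam \<xi>)) powr (- real k)"
    using assms unfolding rapidly_decreasing_def by blast
  \<comment> \<open>Since the weight is at least 1 and \<open>k\<close> is at least
    \<open>s\<close>, decay of order \<open>k\<close> is dominated by the summable family. The
    absolute values allow for constants of unknown sign.\<close>
  have "(\<lambda>\<xi>. \<bar>C\<bar> * \<bar>B\<bar> * (1 + cmod (lam \<xi>)) powr (- s)) summable_on I"
    by (intro summable_on_cmult_right summable)
  then show "(\<lambda>\<xi>. norm (a \<xi> *\<^sub>C u \<xi>)) summable_on I"
  proof (rule summable_on_comparison_test)
    fix \<xi> assume \<xi>: "\<xi> \<in> I"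
    have "C * (1 + cmod (lam \<xi>)) powr (- real k) \<le> \<bar>C\<bar> * (1 + cmod (lam \<xi>)) powr (- s)"
      using k by (intro mult_mono powr_mono) auto
    then have "cmod (a \<xi>) \<le> \<bar>C\<bar> * (1 + cmod (lam \<xi>)) powr (- s)"
      using C[OF \<xi>] by linarith
    moreover have "norm (u \<xi>) \<le> \<bar>B\<bar>" using norm_le[OF \<xi>] by linarith
    ultimately have "cmod (a \<xi>) * norm (u \<xi>) \<le> (\<bar>C\<bar> * (1 + cmod (lam \<xi>)) powr (- s)) * \<bar>B\<bar>"
      by (intro mult_mono') auto
    then show "norm (a \<xi> *\<^sub>C u \<xi>) \<le> \<bar>C\<bar> * \<bar>B\<bar> * (1 + cmod (lam \<xi>)) powr (- s)"
      by (simp add: norm_scaleC mult_ac)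
  qed simp
qed

text \<open>Continuity moves the inner product inside the sum, and biorthogonality leaves only the
  term at \<eta>.\<close>

lemma cinner_series:
  assumes a: "rapidly_decreasing I lam a" and \<eta>: "\<eta> \<in> I"
  shows "cinner (\<Sum>\<^sub>\<infinity>\<xi>\<in>I. a \<xi> *\<^sub>C u \<xi>) (v \<eta>) = a \<eta>"
proof -
  have "cinner (\<Sum>\<^sub>\<infinity>\<xi>\<in>I. a \<xi> *\<^sub>C u \<xi>) (v \<eta>) = (\<Sum>\<^sub>\<infinity>\<xi>\<in>I. cinner (a \<xi> *\<^sub>C u \<xi>) (v \<eta>))"
    using rapidly_decreasing_series_summable[OF a]
      summable_on_bounded_linear[OF bounded_linear_cinner_left]
    by (intro infsum_bounded_linear_strong[symmetric] bounded_linear_cinner_left) blast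
  also have "\<dots> = (\<Sum>\<^sub>\<infinity>\<xi>\<in>{\<eta>}. a \<eta>)"
    using \<eta> by (intro infsum_cong_neutral) (auto simp: cinner_scaleC_left cinner_eq)
  also have "\<dots> = a \<eta>" by simp
  finally show ?thesis .
qed

section \<open>Convolution identities\<close>

abbreviation embed where "embed \<equiv> hilbert_embed I lam u"
abbreviation conv where "conv \<equiv> convolution I u v"

lemma rapidly_decreasing_fourier_embed:
  "g \<in> test_space I lam v \<Longrightarrow> rapidly_decreasing I lam (fourier v (embed g))"
  unfolding mem_test_space_iff by (simp add: fourier_hilbert_embed cong: rapidly_decreasing_cong)

lemma convolution_commute: "conv f g = conv g f"
  by (simp add: convolution_def mult.commute)

text \<open>The condition on \<open>f\<close> concerns only its coefficients, so the lemma covers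
  distributions and embedded test functions alike.\<close>

lemma fourier_convolution:
  assumes "polynomially_bounded I lam (fourier v f)" and "g \<in> test_space I lam v" and "\<xi> \<in> I"
  shows "fourier v (embed (conv f (embed g))) \<xi> = fourier v f \<xi> * fourier v (embed g) \<xi>"
  unfolding fourier_hilbert_embed[OF assms(3), of "conv f (embed g)"]
  unfolding convolution_def
  by (rule cinner_series[OF rapidly_decreasing_mult[OF assms(1)
      rapidly_decreasing_fourier_embed[OF assms(2)]] assms(3)])

lemma convolution_mem_test_space:
  assumes "polynomially_bounded I lam (fourier v f)" and "g \<in> test_space I lam v"
  shows "conv f (embed g) \<in> test_space I lam v"
proof -
  have "rapidly_decreasing I lam (\<lambda>\<xi>. fourier v f \<xi> * fourier v (embed g) \<xi>)"
    by (intro rapidly_decreasing_mult assms rapidly_decreasing_fourier_embed)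
  moreover have "cinner (conv f (embed g)) (v \<xi>) = fourier v f \<xi> * fourier v (embed g) \<xi>"
    if "\<xi> \<in> I" for \<xi>
    using fourier_convolution[OF assms that] by (simp add: fourier_hilbert_embed that)
  ultimately show ?thesis
    unfolding mem_test_space_iff by (simp cong: rapidly_decreasing_cong)
qed

text \<open>Both sides expand in \<open>u\<close> with the same triple product of coefficients, so
  the series agree term by term.\<close>

lemma convolution_assoc:
  assumes f: "polynomially_bounded I lam (fourier v f)"
    and g: "g \<in> test_space I lam v" and k: "k \<in> test_space I lam v"
  shows "conv (embed (conv f (embed g))) (embed k) = conv f (embed (conv (embed g) (embed k)))"
proof -
  have "polynomially_bounded I lam (fourier v (embed g))"
    by (intro rapidly_decreasing_imp_polynomially_bounded rapidly_decreasing_fourier_embed g)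
  note gk = fourier_convolution[OF this k] and fg = fourier_convolution[OF f g]
  show ?thesis
    unfolding convolution_def[of I u v "embed (conv f (embed g))"]
      convolution_def[of I u v f "embed (conv (embed g) (embed k))"]
    by (rule infsum_cong) (use gk fg in \<open>simp add: mult.assoc\<close>)
qed

text \<open>The possible distribution \<open>f\<close> may stand first, in the middle or last.
  Commutativity reduces each position to \<open>f\<close> standing first, using associativity for
  both orders of \<open>g\<close> and \<open>k\<close>.\<close>

lemma convolution_assoc_all:
  assumes f: "polynomially_bounded I lam (fourier v f)"
    and g: "g \<in> test_space I lam v" and k: "k \<in> test_space I lam v"
  shows "conv (embed (conv f (embed g))) (embed k) = conv f (embed (conv (embed g) (embed k))) \<and>
    conv (embed (conv (embed g) f)) (embed k) = conv (embed g) (embed (conv f (embed k))) \<and>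
    conv (embed (conv (embed g) (embed k))) f = conv (embed g) (embed (conv (embed k) f))"
  using convolution_assoc[OF f g k] convolution_assoc[OF f k g] by (metis convolution_commute)

lemma factor_polynomially_bounded:
  assumes "f \<in> antidual I lam u \<union> embed ` test_space I lam v"
  shows "polynomially_bounded I lam (fourier v f)"
  using assms fourier_antidual_polynomially_bounded
    rapidly_decreasing_imp_polynomially_bounded[OF rapidly_decreasing_fourier_embed] by blast

end

theorem proposition4p3:
  fixes I :: "'i set"
    and u v :: "'i \<Rightarrow> 'a::complex_hilbert"
    and lam :: "'i \<Rightarrow> complex"
    and s0 :: real
    and CU CV :: "'a set"
    and DU DV :: "('a \<Rightarrow> complex) set"
    and \<iota>U \<iota>V :: "'a \<Rightarrow> 'a \<Rightarrow> complex"
    and hatU hatV :: "('a \<Rightarrow> complex) \<Rightarrow> 'i \<Rightarrow> complex"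
    and convU (infixl \<open>\<star>\<^sub>U\<close> 70)
    and convV (infixl \<open>\<star>\<^sub>V\<close> 70)
  defines "CU \<equiv> test_space I lam v"
    and "CV \<equiv> test_space I lam u"
    and "DU \<equiv> antidual I lam u"
    and "DV \<equiv> antidual I lam v"
    and "\<iota>U \<equiv> hilbert_embed I lam u"
    and "\<iota>V \<equiv> hilbert_embed I lam v"
    and "hatU \<equiv> fourier v"
    and "hatV \<equiv> fourier u"
    and "convU \<equiv> convolution I u v"
    and "convV \<equiv> convolution I v u"
  assumes separable: "separable_space (euclidean :: 'a topology)"
    and countable: "countable I"
    and riesz: "riesz_basis I u"
    and biorth: "biorthogonal I u v"
    and s0: "s0 > 0"
    and lam: "(\<lambda>\<xi>. (1 + cmod (lam \<xi>)) powr (- s0)) summable_on I"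
  shows "
    (\<forall>f\<in>DU. \<forall>g\<in>CU. \<forall>\<xi>\<in>I.
        hatU (\<iota>U (f \<star>\<^sub>U \<iota>U g)) \<xi> = hatU f \<xi> * hatU (\<iota>U g) \<xi>) \<and>
    (\<forall>h\<in>DV. \<forall>j\<in>CV. \<forall>\<xi>\<in>I.
        hatV (\<iota>V (h \<star>\<^sub>V \<iota>V j)) \<xi> = hatV h \<xi> * hatV (\<iota>V j) \<xi>) \<and>
    (\<forall>f \<in> DU \<union> \<iota>U ` CU. \<forall>g\<in>CU. f \<star>\<^sub>U \<iota>U g = \<iota>U g \<star>\<^sub>U f) \<and>
    (\<forall>h \<in> DV \<union> \<iota>V ` CV. \<forall>j\<in>CV. h \<star>\<^sub>V \<iota>V j = \<iota>V j \<star>\<^sub>V h) \<and>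
    (\<forall>f \<in> DU \<union> \<iota>U ` CU. \<forall>g\<in>CU. \<forall>k\<in>CU.
        \<iota>U (f \<star>\<^sub>U \<iota>U g) \<star>\<^sub>U \<iota>U k = f \<star>\<^sub>U \<iota>U (\<iota>U g \<star>\<^sub>U \<iota>U k) \<and>
        \<iota>U (\<iota>U g \<star>\<^sub>U f) \<star>\<^sub>U \<iota>U k = \<iota>U g \<star>\<^sub>U \<iota>U (f \<star>\<^sub>U \<iota>U k) \<and>
        \<iota>U (\<iota>U g \<star>\<^sub>U \<iota>U k) \<star>\<^sub>U f = \<iota>U g \<star>\<^sub>U \<iota>U (\<iota>U k \<star>\<^sub>U f)) \<and>
    (\<forall>h \<in> DV \<union> \<iota>V ` CV. \<forall>j\<in>CV. \<forall>k\<in>CV.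
        \<iota>V (h \<star>\<^sub>V \<iota>V j) \<star>\<^sub>V \<iota>V k = h \<star>\<^sub>V \<iota>V (\<iota>V j \<star>\<^sub>V \<iota>V k) \<and>
        \<iota>V (\<iota>V j \<star>\<^sub>V h) \<star>\<^sub>V \<iota>V k = \<iota>V j \<star>\<^sub>V \<iota>V (h \<star>\<^sub>V \<iota>V k) \<and>
        \<iota>V (\<iota>V j \<star>\<^sub>V \<iota>V k) \<star>\<^sub>V h = \<iota>V j \<star>\<^sub>V \<iota>V (\<iota>V k \<star>\<^sub>V h)) \<and>
    (\<forall>g\<in>CU. \<forall>f\<in>DU. f \<star>\<^sub>U \<iota>U g \<in> CU)"
proof -
  obtain BU where BU: "\<And>\<xi>. \<xi> \<in> I \<Longrightarrow> norm (u \<xi>) \<le> BU"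
    using riesz_basis_bounded[OF riesz] by blast
  obtain BV where BV: "\<And>\<xi>. \<xi> \<in> I \<Longrightarrow> norm (v \<xi>) \<le> BV"
    using riesz_basis_biorthogonal_bounded[OF riesz biorth] by blast
  interpret U: biorthogonal_system I u v lam s0 BU
    by unfold_locales (fact biorth lam BU)+
  interpret V: biorthogonal_system I v u lam s0 BV
    by unfold_locales (fact biorthogonal_sym[OF biorth] lam BV)+
  show ?thesis
    unfolding CU_def CV_def DU_def DV_def \<iota>U_def \<iota>V_def hatU_def hatV_def convU_def convV_def
    \<comment> \<open>The nested \<open>conjI\<close> splits only the seven outer conjuncts and
      keeps each associativity triple whole, matching \<open>convolution_assoc_all\<close>.\<close>
    by (intro conjI[OF _ conjI[OF _ conjI[OF _ conjI[OF _ conjI[OF _ conjI]]]]] ballI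
        U.fourier_convolution V.fourier_convolution U.convolution_commute V.convolution_commute
        U.convolution_assoc_all V.convolution_assoc_all U.convolution_mem_test_space
        U.factor_polynomially_bounded V.factor_polynomially_bounded) simp_all
qed

end
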